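(* Let $\diamond$ be a left-continuous t-norm with $\alpha\diamond\alpha\ge\alpha$ for all $\alpha\in[0,1]$, and let $(X,\mathcal{F},\tau_\diamond)$ be a complete PM space, where $\tau_\diamond(F,G)(x)=F(x)\diamond G(x)$ for all $F,G\in\Delta^+$ and $x\ge 0$. Let $x_0\in X$, $r\in(0,1)$, $t>0$, and let $\overline{S_t}(x_0,r,\mathcal{F})=\{x\in X:F_{x,x_0}(t)\ge 1-r\}$. Let $f:X\to X$ be a probabilistic TSR-contraction mapping on $\overline{S_t}(x_0,r,\mathcal{F})$; that is, for every $u>0$ there exists $k\in(0,1)$ such that $$1-F_{f(x),f(y)}(ku)\le k\bigl(1-F_{x,y}(u)\bigr)\quad\text{for all }x,y\in\overline{S_t}(x_0,r,\mathcal{F}).$$ Suppose moreover that $F_{x_0,f(x_0)}(u)>1-r$ for all $u>0$. Then $f$ has a unique fixed point in $\overline{S_t}(x_0,r,\mathcal{F})$.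
   Context: A t-norm is a binary operation $\diamond$ on $[0,1]$ that is commutative, associative, non-decreasing in each argument, and satisfies $x\diamond 1=x$. A distance distribution function is a non-decreasing function $F:[-\infty,\infty]\to[0,1]$, left continuous on $\mathbb{R}$, with $F(-\infty)=0$, $F(\infty)=1$, $F(0)=0$; the set of these is $\Delta^+$. $H_0\in\Delta^+$ is given by $H_0(u)=0$ for $u\le 0$ and $H_0(u)=1$ for $u>0$. A triangle function is a binary operation $\tau$ on $\Delta^+$ that is commutative, associative, non-decreasing in each place (pointwise order), with identity $H_0$. A probabilistic metric space (PM space) is a triple $(X,\mathcal{F},\tau)$ with $X$ a nonempty set, $\tau$ a triangle function, and $\mathcal{F}:X\times X\to\Delta^+$, $(p,q)\mapsto F_{p,q}$, such that for all $p,q,r\in X$: (i) $F_{p,q}=H_0$ iff $p=q$; (ii) $F_{p,q}=F_{q,p}$; (iii) $F_{p,r}\ge\tau(F_{p,q},F_{q,r})$. A sequence $\{x_n\}$ in $X$ converges to $x\in X$ if for all $\alpha\in(0,1)$ and $t>0$ there is a natural number $m$ with $F_{x_n,x}(t)>1-\alpha$ for all $n\ge m$. It is a Cauchy sequence if for all $\alpha\in(0,1)$ and $t>0$ there is a natural number $m$ with $F_{x_{n+p},x_n}(t)>1-\alpha$ for all $n\ge m$ and all natural numbers $p$. The space is complete if every Cauchy sequence converges to a point of $X$. The contraction constant $k$ may depend on $u$ but not on $x,y$. *)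

theory Defs
  imports Complex_Main "HOL-Library.Extended_Real" "HOL-Library.FuncSet"
begin

text \<open>Binary operations on \<open>[0,1]\<close> are functions \<open>real \<Rightarrow> real \<Rightarrow> real\<close>; their values outside
  the unit square are irrelevant.\<close>

locale t_norm =
  fixes T :: "real \<Rightarrow> real \<Rightarrow> real"
  assumes closed: "x \<in> {0..1} \<Longrightarrow> y \<in> {0..1} \<Longrightarrow> T x y \<in> {0..1}"
    and commute: "x \<in> {0..1} \<Longrightarrow> y \<in> {0..1} \<Longrightarrow> T x y = T y x"
    and assoc: "x \<in> {0..1} \<Longrightarrow> y \<in> {0..1} \<Longrightarrow> z \<in> {0..1} \<Longrightarrow> T (T x y) z = T x (T y z)"
    and mono_left: "x \<in> {0..1} \<Longrightarrow> x' \<in> {0..1} \<Longrightarrow> y \<in> {0..1} \<Longrightarrow> x \<le> x' \<Longrightarrow> T x y \<le> T x' y"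
    and mono_right: "x \<in> {0..1} \<Longrightarrow> y \<in> {0..1} \<Longrightarrow> y' \<in> {0..1} \<Longrightarrow> y \<le> y' \<Longrightarrow> T x y \<le> T x y'"
    and right_one: "x \<in> {0..1} \<Longrightarrow> T x 1 = x"

text \<open>Left continuity in the first argument; by commutativity a t-norm that satisfies this is
  left continuous in each argument. There is nothing to the left of \<open>0\<close> in \<open>[0,1]\<close>.\<close>

definition left_continuous_op :: "(real \<Rightarrow> real \<Rightarrow> real) \<Rightarrow> bool" where
  "left_continuous_op T \<longleftrightarrow>
     (\<forall>x\<in>{0<..1}. \<forall>y\<in>{0..1}. continuous (at_left x) (\<lambda>z. T z y))"

definition Delta_plus :: "(ereal \<Rightarrow> real) set" where
  "Delta_plus = {F. mono F \<and> range F \<subseteq> {0..1} \<and>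
     (\<forall>x::real. continuous (at_left (ereal x)) F) \<and>
     F (-\<infinity>) = 0 \<and> F \<infinity> = 1 \<and> F 0 = 0}"

definition H0 :: "ereal \<Rightarrow> real" where
  "H0 u = (if u \<le> 0 then 0 else 1)"

text \<open>The order on \<^const>\<open>Delta_plus\<close> is the pointwise order of functions.\<close>

locale triangle_function =
  fixes \<tau> :: "(ereal \<Rightarrow> real) \<Rightarrow> (ereal \<Rightarrow> real) \<Rightarrow> (ereal \<Rightarrow> real)"
  assumes closed: "F \<in> Delta_plus \<Longrightarrow> G \<in> Delta_plus \<Longrightarrow> \<tau> F G \<in> Delta_plus"
    and commute: "F \<in> Delta_plus \<Longrightarrow> G \<in> Delta_plus \<Longrightarrow> \<tau> F G = \<tau> G F"
    and assoc: "F \<in> Delta_plus \<Longrightarrow> G \<in> Delta_plus \<Longrightarrow> H \<in> Delta_plus \<Longrightarrow>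
                  \<tau> (\<tau> F G) H = \<tau> F (\<tau> G H)"
    and mono_left: "F \<in> Delta_plus \<Longrightarrow> F' \<in> Delta_plus \<Longrightarrow> G \<in> Delta_plus \<Longrightarrow> F \<le> F' \<Longrightarrow>
                  \<tau> F G \<le> \<tau> F' G"
    and mono_right: "F \<in> Delta_plus \<Longrightarrow> G \<in> Delta_plus \<Longrightarrow> G' \<in> Delta_plus \<Longrightarrow> G \<le> G' \<Longrightarrow>
                  \<tau> F G \<le> \<tau> F G'"
    and right_H0: "F \<in> Delta_plus \<Longrightarrow> \<tau> F H0 = F"

text \<open>Elements of \<^const>\<open>Delta_plus\<close> vanish on the negative half-line, which forces the value
  \<open>0\<close> there.\<close>

definition tau_of :: "(real \<Rightarrow> real \<Rightarrow> real) \<Rightarrow> (ereal \<Rightarrow> real) \<Rightarrow> (ereal \<Rightarrow> real) \<Rightarrow> ereal \<Rightarrow> real" where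
  "tau_of T F G x = (if x \<ge> 0 then T (F x) (G x) else 0)"

locale pm_space = triangle_function \<tau>
  for X :: "'a set"
    and F :: "'a \<Rightarrow> 'a \<Rightarrow> ereal \<Rightarrow> real"
    and \<tau> :: "(ereal \<Rightarrow> real) \<Rightarrow> (ereal \<Rightarrow> real) \<Rightarrow> (ereal \<Rightarrow> real)" +
  assumes nonempty: "X \<noteq> {}"
    and in_Delta_plus: "p \<in> X \<Longrightarrow> q \<in> X \<Longrightarrow> F p q \<in> Delta_plus"
    and eq_H0_iff: "p \<in> X \<Longrightarrow> q \<in> X \<Longrightarrow> F p q = H0 \<longleftrightarrow> p = q"
    and sym: "p \<in> X \<Longrightarrow> q \<in> X \<Longrightarrow> F p q = F q p"
    and triangle: "p \<in> X \<Longrightarrow> q \<in> X \<Longrightarrow> r \<in> X \<Longrightarrow> F p r \<ge> \<tau> (F p q) (F q r)"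

definition pm_converges :: "('a \<Rightarrow> 'a \<Rightarrow> ereal \<Rightarrow> real) \<Rightarrow> (nat \<Rightarrow> 'a) \<Rightarrow> 'a \<Rightarrow> bool" where
  "pm_converges F s x \<longleftrightarrow>
     (\<forall>\<alpha>\<in>{0<..<1::real}. \<forall>t>0::real. \<exists>m. \<forall>n\<ge>m. F (s n) x (ereal t) > 1 - \<alpha>)"

definition pm_Cauchy :: "('a \<Rightarrow> 'a \<Rightarrow> ereal \<Rightarrow> real) \<Rightarrow> (nat \<Rightarrow> 'a) \<Rightarrow> bool" where
  "pm_Cauchy F s \<longleftrightarrow>
     (\<forall>\<alpha>\<in>{0<..<1::real}. \<forall>t>0::real. \<exists>m. \<forall>n\<ge>m. \<forall>p. F (s (n + p)) (s n) (ereal t) > 1 - \<alpha>)"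

definition pm_complete :: "'a set \<Rightarrow> ('a \<Rightarrow> 'a \<Rightarrow> ereal \<Rightarrow> real) \<Rightarrow> bool" where
  "pm_complete X F \<longleftrightarrow>
     (\<forall>s. range s \<subseteq> X \<and> pm_Cauchy F s \<longrightarrow> (\<exists>x\<in>X. pm_converges F s x))"

definition pm_cball :: "'a set \<Rightarrow> ('a \<Rightarrow> 'a \<Rightarrow> ereal \<Rightarrow> real) \<Rightarrow> real \<Rightarrow> 'a \<Rightarrow> real \<Rightarrow> 'a set" where
  "pm_cball X F t x\<^sub>0 r = {x \<in> X. F x x\<^sub>0 (ereal t) \<ge> 1 - r}"

text \<open>The constant \<open>k\<close> is chosen after \<open>u\<close> and before \<open>x\<close>, \<open>y\<close>.\<close>

definition TSR_contraction_on ::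
    "'a set \<Rightarrow> ('a \<Rightarrow> 'a \<Rightarrow> ereal \<Rightarrow> real) \<Rightarrow> ('a \<Rightarrow> 'a) \<Rightarrow> bool" where
  "TSR_contraction_on A F f \<longleftrightarrow>
     (\<forall>u>0::real. \<exists>k\<in>{0<..<1::real}. \<forall>x\<in>A. \<forall>y\<in>A.
        1 - F (f x) (f y) (ereal (k * u)) \<le> k * (1 - F x y (ereal u)))"

end

theory Submission
  imports Defs
begin

text \<open>The condition \<open>T \<alpha> \<alpha> \<ge> \<alpha>\<close> forces \<open>T\<close> to dominate the minimum, so for each fixed \<open>u > 0\<close> the
  function \<open>(p, q) \<mapsto> 1 - F p q u\<close> is an ultra-pseudometric, and by monotonicity of \<open>F p q\<close> the
  map \<open>f\<close> contracts it with the constant \<open>k\<close> belonging to \<open>u\<close>. The Picard iterates of \<open>x\<^sub>0\<close> are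
  therefore Cauchy for all these pseudometrics simultaneously, although \<open>k\<close> depends on \<open>u\<close>, and
  the ultrametric inequality keeps the closed ball invariant.\<close>

lemma (in t_norm) min_le_if_le_diag:
  assumes diag: "\<forall>\<alpha>\<in>{0..1}. \<alpha> \<le> T \<alpha> \<alpha>" and a: "a \<in> {0..1}" and b: "b \<in> {0..1}"
  shows "min a b \<le> T a b"
proof -
  have m: "min a b \<in> {0..1}" using a b by auto
  have "min a b \<le> T (min a b) (min a b)" using diag m by blast
  also have "\<dots> \<le> T a (min a b)" by (rule mono_left[OF m a m]) simp
  also have "\<dots> \<le> T a b" by (rule mono_right[OF a m b]) simp
  finally show ?thesis .
qed

context pm_space
begin

lemma prob_bounds: "p \<in> X \<Longrightarrow> q \<in> X \<Longrightarrow> F p q u \<in> {0..1}"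
  using in_Delta_plus[of p q] unfolding Delta_plus_def by blast

lemma prob_mono: "p \<in> X \<Longrightarrow> q \<in> X \<Longrightarrow> u \<le> v \<Longrightarrow> F p q u \<le> F p q v"
  using in_Delta_plus[of p q] by (auto simp: Delta_plus_def mono_def)

lemma prob_self: "p \<in> X \<Longrightarrow> 0 < u \<Longrightarrow> F p p u = 1"
  using eq_H0_iff[of p p] by (auto simp: H0_def)

lemma eq_if_prob_one:
  assumes p: "p \<in> X" and q: "q \<in> X" and one: "\<And>u::real. 0 < u \<Longrightarrow> F p q (ereal u) \<ge> 1"
  shows "p = q"
proof -
  have "F p q v = H0 v" for v
  proof (cases "v \<le> 0")
    case True
    then have "F p q v \<le> F p q 0" by (rule prob_mono[OF p q])
    also have "\<dots> = 0" using in_Delta_plus[OF p q] by (simp add: Delta_plus_def)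
    finally show ?thesis using prob_bounds[OF p q, of v] True by (simp add: H0_def)
  next
    case False
    \<comment> \<open>\<open>v\<close> may be infinite while \<open>one\<close> speaks of real
      scales only. A real strictly between 0 and \<open>v\<close> carries the value 1 up to
      \<open>v\<close> by monotonicity.\<close>
    then obtain u :: real where "0 < u" "ereal u \<le> v"
      using ereal_dense2[of 0 v] by (force simp: zero_ereal_def)
    then have "1 \<le> F p q v"
      using one[of u] prob_mono[OF p q, of "ereal u" v] by linarith
    then show ?thesis using prob_bounds[OF p q, of v] False by (simp add: H0_def)
  qed
  then show ?thesis using eq_H0_iff[OF p q] by blast
qed

text \<open>Since \<open>k * u < u\<close>, the shrinking of the scale can be given up. Iterating
  the original inequality would move from \<open>u\<close> to \<open>k * u\<close>, where another
  constant applies; here a single \<open>k\<close> serves all iterations at a fixed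
  \<open>u\<close>.\<close>

lemma TSR_contraction_on_same_scale:
  assumes "TSR_contraction_on A F f" and A: "A \<subseteq> X" and f: "f \<in> A \<rightarrow> X" and u: "0 < (u::real)"
  obtains k where "0 < k" "k < 1"
    "\<And>x y. x \<in> A \<Longrightarrow> y \<in> A \<Longrightarrow> 1 - F (f x) (f y) (ereal u) \<le> k * (1 - F x y (ereal u))"
proof -
  from assms(1) u obtain k where k: "0 < k" "k < 1" and
    c: "\<And>x y. x \<in> A \<Longrightarrow> y \<in> A \<Longrightarrow> 1 - F (f x) (f y) (ereal (k * u)) \<le> k * (1 - F x y (ereal u))"
    unfolding TSR_contraction_on_def by force
  have "1 - F (f x) (f y) (ereal u) \<le> k * (1 - F x y (ereal u))" if "x \<in> A" "y \<in> A" for x y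
  proof -
    have "F (f x) (f y) (ereal (k * u)) \<le> F (f x) (f y) (ereal u)"
      using that A f u k by (intro prob_mono) auto
    then show ?thesis using c[OF that] by linarith
  qed
  with k that show thesis by blast
qed

lemma TSR_contraction_on_fixed_point_unique:
  assumes con: "TSR_contraction_on A F f" and A: "A \<subseteq> X" and f: "f \<in> A \<rightarrow> X"
    and x: "x \<in> A" "f x = x" and y: "y \<in> A" "f y = y"
  shows "x = y"
proof (rule eq_if_prob_one)
  show "x \<in> X" "y \<in> X" using x y A by auto
  fix u :: real assume u: "0 < u"
  obtain k where k: "0 < k" "k < 1"
    and c: "\<And>x y. x \<in> A \<Longrightarrow> y \<in> A \<Longrightarrow> 1 - F (f x) (f y) (ereal u) \<le> k * (1 - F x y (ereal u))"
    using TSR_contraction_on_same_scale[OF con A f u] by metis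
  \<comment> \<open>For two fixed points the contraction bounds \<open>1 - F x y u\<close> by
    \<open>k\<close> times itself.\<close>
  have "(1 - k) * (1 - F x y (ereal u)) \<le> 0"
    using c[OF x(1) y(1)] x(2) y(2) by (simp add: algebra_simps)
  then show "1 \<le> F x y (ereal u)" using k by (simp add: mult_le_0_iff)
qed

end

text \<open>The added inequality is the strong triangle inequality for \<open>1 - F p q u\<close>,
  stated scale by scale. It is all that the arguments below need of the t-norm;
  \<open>0 \<le> u\<close> is the range on which \<open>tau_of T\<close> is given by
  \<open>T\<close>.\<close>

locale ultra_pm_space = pm_space +
  assumes ultra: "\<And>p q r u. p \<in> X \<Longrightarrow> q \<in> X \<Longrightarrow> r \<in> X \<Longrightarrow> 0 \<le> u \<Longrightarrow>
    min (F p q u) (F q r u) \<le> F p r u"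
begin

text \<open>A chain of steps is no longer than its longest step, so no geometric series has to be
  summed.\<close>

lemma Cauchy_if_geometric:
  assumes s: "range s \<subseteq> X"
    and geo: "\<And>u. 0 < u \<Longrightarrow>
      \<exists>k. 0 < k \<and> k < 1 \<and> (\<forall>n. 1 - F (s (Suc n)) (s n) (ereal u) \<le> k ^ n)"
  shows "pm_Cauchy F s"
  unfolding pm_Cauchy_def
proof (intro ballI allI impI)
  fix \<alpha> u :: real
  assume \<alpha>: "\<alpha> \<in> {0<..<1}" and u: "0 < u"
  from geo[OF u] obtain k where k: "0 < k" "k < 1"
    and step: "\<And>n. 1 - F (s (Suc n)) (s n) (ereal u) \<le> k ^ n"
    by blast
  have X: "s n \<in> X" for n using s by blast
  \<comment> \<open>The bound is uniform in \<open>p\<close>, as the Cauchy condition fixes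
    \<open>m\<close> before \<open>p\<close>.\<close>
  have bound: "1 - F (s (n + p)) (s n) (ereal u) \<le> k ^ n" for n p
  proof (induction p)
    case 0
    show ?case using prob_self[OF X] u k by simp
  next
    case (Suc p)
    have "1 - F (s (Suc (n + p))) (s (n + p)) (ereal u) \<le> k ^ (n + p)" by (rule step)
    also have "\<dots> \<le> k ^ n" using k by (intro power_decreasing) auto
    finally show ?case
      using Suc ultra[OF X[of "n + Suc p"] X[of "n + p"] X[of n], of "ereal u"] u
      by (auto simp: min_def split: if_splits)
  qed
  obtain m where m: "k ^ m < \<alpha>" using real_arch_pow_inv[of \<alpha> k] \<alpha> k by auto
  show "\<exists>m. \<forall>n\<ge>m. \<forall>p. F (s (n + p)) (s n) (ereal u) > 1 - \<alpha>"
  proof (intro exI[of _ m] allI impI)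
    fix n p assume "m \<le> n"
    then have "k ^ n \<le> k ^ m" using k by (intro power_decreasing) auto
    then show "F (s (n + p)) (s n) (ereal u) > 1 - \<alpha>" using bound[of n p] m by linarith
  qed
qed

text \<open>One term of the sequence within \<open>r\<close> of \<open>x\<close> at scale
  \<open>t\<close> suffices, because radii do not add up. No continuity of \<open>F\<close> in its
  points is involved.\<close>

lemma cball_limit:
  assumes lim: "pm_converges F s x" and x: "x \<in> X" and a: "a \<in> X"
    and s: "range s \<subseteq> pm_cball X F t a r" and r: "r \<in> {0<..<1}" and t: "0 < t"
  shows "x \<in> pm_cball X F t a r"
proof -
  from lim r t obtain n where n: "F (s n) x (ereal t) > 1 - r"
    unfolding pm_converges_def by blast
  have sn: "s n \<in> X" "1 - r \<le> F (s n) a (ereal t)"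
    using s by (auto simp: pm_cball_def)
  have "F x (s n) (ereal t) > 1 - r" using n sym[OF sn(1) x] by simp
  then show ?thesis
    using ultra[OF x sn(1) a, of "ereal t"] sn(2) x t by (auto simp: pm_cball_def)
qed

lemma fixed_point_if_Picard_limit:
  assumes con: "TSR_contraction_on A F f" and A: "A \<subseteq> X" and f: "f \<in> A \<rightarrow> X"
    and s: "range s \<subseteq> A" and rec: "\<And>n. s (Suc n) = f (s n)"
    and x: "x \<in> A" and lim: "pm_converges F s x"
  shows "f x = x"
proof (rule eq_if_prob_one)
  show fx: "f x \<in> X" and xX: "x \<in> X" using x A f by auto
  fix u :: real assume u: "0 < u"
  obtain k where k: "0 < k" "k < 1"
    and c: "\<And>x y. x \<in> A \<Longrightarrow> y \<in> A \<Longrightarrow> 1 - F (f x) (f y) (ereal u) \<le> k * (1 - F x y (ereal u))"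
    using TSR_contraction_on_same_scale[OF con A f u] by metis
  \<comment> \<open>The detour from \<open>f x\<close> to \<open>x\<close> goes through
    \<open>s (Suc m) = f (s m)\<close>: the first leg is short because \<open>f\<close> does not
    increase the distance from \<open>x\<close> to \<open>s m\<close>, the second by
    convergence.\<close>
  have close: "1 - e \<le> F (f x) x (ereal u)" if e: "0 < e" "e < 1" for e
  proof -
    from lim e u obtain m where m: "\<forall>n\<ge>m. F (s n) x (ereal u) > 1 - e"
      unfolding pm_converges_def by force
    have sA: "s m \<in> A" and sX: "s m \<in> X" "s (Suc m) \<in> X" using s A by auto
    have "1 - F (f x) (s (Suc m)) (ereal u) \<le> k * (1 - F x (s m) (ereal u))"
      using c[OF x sA] rec by simp
    also have "\<dots> \<le> 1 * (1 - F x (s m) (ereal u))"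
      using k prob_bounds[OF xX sX(1)] by (intro mult_right_mono) auto
    also have "\<dots> < e" using m sym[OF xX sX(1)] by auto
    finally show ?thesis
      using ultra[OF fx sX(2) xX, of "ereal u"] m[rule_format, of "Suc m"] u by auto
  qed
  show "1 \<le> F (f x) x (ereal u)"
  proof (rule ccontr)
    assume "\<not> ?thesis"
    then have "0 < 1 - F (f x) x (ereal u)" by simp
    \<comment> \<open>Half of the deficit is admissible for \<open>e\<close>: it is positive, and at
      most 1/2 as values of \<open>F\<close> are nonnegative.\<close>
    with close[of "(1 - F (f x) x (ereal u)) / 2"] prob_bounds[OF fx xX, of "ereal u"]
    show False by (auto simp: field_simps)
  qed
qed

end

theorem theorem4p4:
  fixes T :: "real \<Rightarrow> real \<Rightarrow> real"
    and X :: "'a set"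
    and F :: "'a \<Rightarrow> 'a \<Rightarrow> ereal \<Rightarrow> real"
    and x\<^sub>0 :: 'a and r t :: real
    and f :: "'a \<Rightarrow> 'a"
  assumes "t_norm T"
    and "left_continuous_op T"
    and "\<forall>\<alpha>\<in>{0..1}. T \<alpha> \<alpha> \<ge> \<alpha>"
    and "pm_space X F (tau_of T)"
    and "pm_complete X F"
    and "x\<^sub>0 \<in> X"
    and "r \<in> {0<..<1}"
    and "t > 0"
    and "f \<in> X \<rightarrow> X"
    and "TSR_contraction_on (pm_cball X F t x\<^sub>0 r) F f"
    and "\<forall>u>0::real. F x\<^sub>0 (f x\<^sub>0) (ereal u) > 1 - r"
  shows "\<exists>!x. x \<in> pm_cball X F t x\<^sub>0 r \<and> f x = x"
proof -
  interpret t_norm T by fact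
  interpret pm_space X F "tau_of T" by fact
  interpret ultra_pm_space X F "tau_of T"
  proof
    fix p q r and u :: ereal
    assume X: "p \<in> X" "q \<in> X" "r \<in> X" and u: "0 \<le> u"
    have "min (F p q u) (F q r u) \<le> T (F p q u) (F q r u)"
      using X by (intro min_le_if_le_diag[OF assms(3)] prob_bounds)
    also have "\<dots> = tau_of T (F p q) (F q r) u" using u by (simp add: tau_of_def)
    also have "\<dots> \<le> F p r u" using triangle[OF X] by (simp add: le_fun_def)
    finally show "min (F p q u) (F q r u) \<le> F p r u" .
  qed
  let ?B = "pm_cball X F t x\<^sub>0 r"
  note x0 = \<open>x\<^sub>0 \<in> X\<close> and con = \<open>TSR_contraction_on ?B F f\<close> and r = \<open>r \<in> {0<..<1}\<close> and t = \<open>t > 0\<close>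
  have B: "?B \<subseteq> X" by (auto simp: pm_cball_def)
  have f: "f \<in> ?B \<rightarrow> X" using \<open>f \<in> X \<rightarrow> X\<close> B by auto
  have x0B: "x\<^sub>0 \<in> ?B" using x0 r t prob_self[OF x0, of "ereal t"] by (simp add: pm_cball_def)
  \<comment> \<open>The point \<open>f x\<close> is within \<open>r\<close> of
    \<open>f x\<^sub>0\<close> by contraction, and \<open>f x\<^sub>0\<close> is within
    \<open>r\<close> of \<open>x\<^sub>0\<close> by the hypothesis on the first step.\<close>
  have fB: "f x \<in> ?B" if x: "x \<in> ?B" for x
  proof -
    have xX: "x \<in> X" "1 - r \<le> F x x\<^sub>0 (ereal t)" using x by (auto simp: pm_cball_def)
    have fX: "f x \<in> X" "f x\<^sub>0 \<in> X" using x x0B f by auto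
    obtain k where k: "0 < k" "k < 1"
      and c: "1 - F (f x) (f x\<^sub>0) (ereal t) \<le> k * (1 - F x x\<^sub>0 (ereal t))"
      using TSR_contraction_on_same_scale[OF con B f t] x x0B by metis
    note c
    also have "k * (1 - F x x\<^sub>0 (ereal t)) \<le> 1 * (1 - F x x\<^sub>0 (ereal t))"
      using k prob_bounds[OF xX(1) x0] by (intro mult_right_mono) auto
    finally have "1 - r \<le> F (f x) (f x\<^sub>0) (ereal t)" using xX(2) by simp
    moreover have "1 - r < F (f x\<^sub>0) x\<^sub>0 (ereal t)"
      using assms(11) t sym[OF x0 fX(2)] by simp
    ultimately show ?thesis
      using ultra[OF fX x0, of "ereal t"] fX t by (auto simp: pm_cball_def)
  qed
  define s where "s n = (f ^^ n) x\<^sub>0" for n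
  have rec: "s (Suc n) = f (s n)" for n by (simp add: s_def)
  \<comment> \<open>The contraction inequality is available inside the ball only, so every iterate
    must stay there.\<close>
  have sB: "s n \<in> ?B" for n by (induction n) (auto simp: rec fB, simp add: s_def x0B)
  then have s: "range s \<subseteq> ?B" "range s \<subseteq> X" using B by auto
  have "pm_Cauchy F s"
  proof (rule Cauchy_if_geometric[OF s(2)])
    fix u :: real assume u: "0 < u"
    obtain k where k: "0 < k" "k < 1"
      and c: "\<And>x y. x \<in> ?B \<Longrightarrow> y \<in> ?B \<Longrightarrow> 1 - F (f x) (f y) (ereal u) \<le> k * (1 - F x y (ereal u))"
      using TSR_contraction_on_same_scale[OF con B f u] by metis
    have "1 - F (s (Suc n)) (s n) (ereal u) \<le> k ^ n" for n
    proof (induction n)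
      \<comment> \<open>As \<open>k ^ 0 = 1\<close>, nonnegativity of \<open>F\<close> is
        enough.\<close>
      case 0
      have "s (Suc 0) \<in> X" "s 0 \<in> X" using s by auto
      then show ?case using prob_bounds[of "s (Suc 0)" "s 0" "ereal u"] by simp
    next
      case (Suc n)
      have "1 - F (s (Suc (Suc n))) (s (Suc n)) (ereal u) \<le> k * (1 - F (s (Suc n)) (s n) (ereal u))"
        using c[OF sB[of "Suc n"] sB[of n]] by (simp add: rec)
      also have "\<dots> \<le> k * k ^ n" using Suc k by (intro mult_left_mono) auto
      finally show ?case by simp
    qed
    with k show "\<exists>k. 0 < k \<and> k < 1 \<and> (\<forall>n. 1 - F (s (Suc n)) (s n) (ereal u) \<le> k ^ n)" by blast
  qed
  with \<open>pm_complete X F\<close> s(2) obtain x where x: "x \<in> X" "pm_converges F s x"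
    unfolding pm_complete_def by blast
  have xB: "x \<in> ?B" by (rule cball_limit[OF x(2,1) x0 s(1) r t])
  have "f x = x" by (rule fixed_point_if_Picard_limit[OF con B f s(1) rec xB x(2)])
  with xB show ?thesis
    using TSR_contraction_on_fixed_point_unique[OF con B f] by blast
qed

end
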